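(* Let $p$ be a prime number and let $m,d\ge 1$ be integers. Let $U_{p^m}^d$ be the multiplicative group of units of the ring $G_d(\mathbb{Z}_{p^m})$ of polyfunctions in $d$ variables over $\mathbb{Z}_{p^m}$, and let $\Psi_d(p^m)=|G_d(\mathbb{Z}_{p^m})|$. Then $$|U_{p^m}^d|=\left(\frac{p-1}{p}\right)^{dp}\Psi_d(p^m).$$
   Context: $\mathbb{Z}_n=\mathbb{Z}/n\mathbb{Z}$. For a commutative ring $R$ with unit element, $G_d(R)$ is the ring of functions $f:R^d\to R$ for which there is a polynomial $q\in R[x_1,\dots,x_d]$ with $f(\boldsymbol{x})=q(\boldsymbol{x})$ for all $\boldsymbol{x}\in R^d$, with pointwise addition and multiplication.
   Formalization: The exponent dp is replaced by p^d: as printed the formula fails, e.g. for p=2, m=1, d=3 there are 256 polyfunctions and one unit, but the printed formula gives 4; the two exponents give the same claim whenever dp = p^d. *)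

theory Defs
  imports Complex_Main "HOL-Algebra.Indexed_Polynomials" "HOL-Number_Theory.Residues"
begin

text \<open>
  Polynomials in the indeterminates \<open>x\<^sub>0, \<dots>, x\<^sub>d\<^sub>-\<^sub>1\<close> over \<open>R\<close> are the library's indexed polynomials
  over \<open>{..<d}\<close>: a monomial is a multiset of indices, a polynomial maps each monomial to its
  coefficient. The library has no evaluation of such a polynomial at a point of \<open>R\<close>.
\<close>

definition monomial_eval :: "('a, 'b) ring_scheme \<Rightarrow> 'i multiset \<Rightarrow> ('i \<Rightarrow> 'a) \<Rightarrow> 'a" where
  "monomial_eval R M x = (\<Otimes>\<^bsub>R\<^esub>i\<in>set_mset M. x i [^]\<^bsub>R\<^esub> count M i)"

definition indexed_poly_eval ::
    "('a, 'b) ring_scheme \<Rightarrow> ('i multiset \<Rightarrow> 'a) \<Rightarrow> ('i \<Rightarrow> 'a) \<Rightarrow> 'a" where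
  "indexed_poly_eval R q x =
     (\<Oplus>\<^bsub>R\<^esub>M\<in>{M. q M \<noteq> \<zero>\<^bsub>R\<^esub>}. q M \<otimes>\<^bsub>R\<^esub> monomial_eval R M x)"

definition affine_points :: "('a, 'b) ring_scheme \<Rightarrow> nat \<Rightarrow> (nat \<Rightarrow> 'a) set" where
  "affine_points R d = {..<d} \<rightarrow>\<^sub>E carrier R"

text \<open>
  Points of \<open>R\<^sup>d\<close>, and functions on \<open>R\<^sup>d\<close>, are extensional (\<open>undefined\<close> off their domain), so that
  equality in the carrier is equality of functions \<open>R\<^sup>d \<rightarrow> R\<close> and cardinalities are meaningful.
\<close>

definition polyfun_ring :: "('a, 'b) ring_scheme \<Rightarrow> nat \<Rightarrow> ((nat \<Rightarrow> 'a) \<Rightarrow> 'a) ring" where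
  "polyfun_ring R d =
    \<lparr>carrier = {f \<in> affine_points R d \<rightarrow>\<^sub>E carrier R.
        \<exists>q \<in> ring.indexed_pset R {..<d} (carrier R).
          \<forall>x \<in> affine_points R d. f x = indexed_poly_eval R q x},
     monoid.mult = (\<lambda>f g. \<lambda>x\<in>affine_points R d. f x \<otimes>\<^bsub>R\<^esub> g x),
     one = (\<lambda>x\<in>affine_points R d. \<one>\<^bsub>R\<^esub>),
     zero = (\<lambda>x\<in>affine_points R d. \<zero>\<^bsub>R\<^esub>),
     add = (\<lambda>f g. \<lambda>x\<in>affine_points R d. f x \<oplus>\<^bsub>R\<^esub> g x)\<rparr>"

definition polyfun_count :: "nat \<Rightarrow> nat \<Rightarrow> nat" where
  "polyfun_count d n = card (carrier (polyfun_ring (residue_ring (int n)) d))"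

definition polyfun_unit_group :: "nat \<Rightarrow> nat \<Rightarrow> ((nat \<Rightarrow> int) \<Rightarrow> int) monoid" where
  "polyfun_unit_group d n = units_of (polyfun_ring (residue_ring (int n)) d)"

end

theory Submission
  imports Defs
begin

text \<open>
  Let \<open>n = p ^ m\<close>. An integer is invertible modulo \<open>n\<close> exactly when \<open>p\<close> does not divide it. If a
  polyfunction \<open>f\<close> takes only invertible values, then \<open>f ^ (totient n - 1)\<close> is its inverse by Euler's
  theorem, and this is a polyfunction again; so the units are the polyfunctions without a zero modulo
  \<open>p\<close> (\<open>Units_residue_polyfuns\<close>).

  Polynomials respect congruences, so \<open>f x mod p\<close> depends only on \<open>x mod p\<close> (\<open>polyfun_cong\<close>), and
  reducing arguments and values modulo \<open>p\<close> sends \<open>f\<close> to a function from the \<open>p ^ d\<close> points of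
  \<open>\<int>\<^sub>p\<^sup>d\<close> to \<open>\<int>\<^sub>p\<close>. Whether \<open>f\<close> is a unit can be read off from its reduction: it must have no zero.

  Reduction is additive, and it is onto all functions because over the field \<open>\<int>\<^sub>p\<close> every function is
  a polynomial function: Fermat's little theorem makes \<open>\<Prod>i. 1 - (x\<^sub>i - a\<^sub>i) ^ (p - 1)\<close> the
  indicator of the point \<open>a\<close> (\<open>reduce_polyfun_surj\<close>). Hence all its fibres have the same size \<open>K\<close>
  (\<open>card_reduce_preimage\<close>), there are \<open>p ^ (p ^ d) * K\<close> polyfunctions, and
  \<open>(p - 1) ^ (p ^ d) * K\<close> of them are units.
\<close>

section \<open>Evaluation of indexed polynomials\<close>

context cring
begin

lemma monomial_eval_closed:
  assumes "x \<in> I \<rightarrow> carrier R" "set_mset M \<subseteq> I"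
  shows "monomial_eval R M x \<in> carrier R"
  unfolding monomial_eval_def using assms by (intro finprod_closed) auto

lemma monomial_eval_add_mset:
  assumes x: "x \<in> I \<rightarrow> carrier R" and M: "set_mset M \<subseteq> I" and i: "i \<in> I"
  shows "monomial_eval R (add_mset i M) x = monomial_eval R M x \<otimes> x i"
proof -
  \<comment> \<open>Over this larger index set both monomials are products with the same factors, except that the
    left one has one more factor \<open>x i\<close>; it does not matter whether \<open>i\<close> already occurs in \<open>M\<close>.\<close>
  let ?S = "insert i (set_mset M)"
  have c: "x j \<in> carrier R" if "j \<in> ?S" for j
    using that x M i by auto
  have "monomial_eval R (add_mset i M) x = finprod R (\<lambda>j. x j [^] count (add_mset i M) j) ?S"
    by (simp add: monomial_eval_def)
  also have "\<dots> = finprod R (\<lambda>j. x j [^] count M j \<otimes> (if i = j then x j else \<one>)) ?S"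
    using c by (intro finprod_cong') auto
  also have "\<dots> = finprod R (\<lambda>j. x j [^] count M j) ?S \<otimes> finprod R (\<lambda>j. if i = j then x j else \<one>) ?S"
    using c by (intro finprod_multf) auto
  also have "finprod R (\<lambda>j. x j [^] count M j) ?S = monomial_eval R M x"
    unfolding monomial_eval_def using c
    by (intro finprod_mono_neutral_cong_right) (auto simp: not_in_iff)
  also have "finprod R (\<lambda>j. if i = j then x j else \<one>) ?S = x i"
    using c by (intro finprod_singleton) auto
  finally show ?thesis .
qed

lemma indexed_pset_support:
  assumes "q \<in> indexed_pset I (carrier R)"
  shows "finite {M. q M \<noteq> \<zero>}" and "q M \<noteq> \<zero> \<Longrightarrow> set_mset M \<subseteq> I"
proof -
  have "finite {M. q M \<noteq> \<zero>} \<and> (\<forall>M. q M \<noteq> \<zero> \<longrightarrow> set_mset M \<subseteq> I)"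
    using assms
  proof induction
    case (indexed_const k)
    have "{M. ring.indexed_const R k M \<noteq> \<zero>} \<subseteq> {{#}}"
      by (auto simp: indexed_const_def)
    then show ?case
      by (auto dest: finite_subset)
  next
    case (indexed_padd P Q)
    have "{M. indexed_padd P Q M \<noteq> \<zero>} \<subseteq> {M. P M \<noteq> \<zero>} \<union> {M. Q M \<noteq> \<zero>}"
      by (auto simp: indexed_padd_def)
    moreover have "set_mset M \<subseteq> I" if "indexed_padd P Q M \<noteq> \<zero>" for M
      using calculation that indexed_padd.IH by blast
    ultimately show ?case
      using indexed_padd.IH by (meson finite_UnI finite_subset)
  next
    case (indexed_pmult P i)
    have "{M. indexed_pmult P i M \<noteq> \<zero>} \<subseteq> add_mset i ` {M. P M \<noteq> \<zero>}"
    proof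
      fix M assume "M \<in> {M. indexed_pmult P i M \<noteq> \<zero>}"
      then have "i \<in># M" "P (M - {#i#}) \<noteq> \<zero>"
        by (auto simp: indexed_pmult_def split: if_splits)
      then show "M \<in> add_mset i ` {M. P M \<noteq> \<zero>}"
        by (intro image_eqI[of _ _ "M - {#i#}"]) auto
    qed
    moreover have "set_mset M \<subseteq> I" if "indexed_pmult P i M \<noteq> \<zero>" for M
      using calculation that indexed_pmult by fastforce
    ultimately show ?case
      using indexed_pmult.IH by (meson finite_imageI finite_subset)
  qed
  then show "finite {M. q M \<noteq> \<zero>}" "q M \<noteq> \<zero> \<Longrightarrow> set_mset M \<subseteq> I" by auto
qed

lemma indexed_pset_coeff:
  "q \<in> indexed_pset I (carrier R) \<Longrightarrow> q M \<in> carrier R"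
  using indexed_pset_in_carrier[of "carrier R" q I] by (auto simp: carrier_coeff_def)

text \<open>Evaluation sums over the exact support of \<open>q\<close>, and two polynomials seldom have the same support;
  enlarging the index set gives sums that can be added term by term.\<close>

lemma indexed_poly_eval_superset:
  assumes x: "x \<in> I \<rightarrow> carrier R" and q: "q \<in> indexed_pset I (carrier R)"
    and S: "finite S" "{M. q M \<noteq> \<zero>} \<subseteq> S" "\<And>M. M \<in> S \<Longrightarrow> set_mset M \<subseteq> I"
  shows "indexed_poly_eval R q x = finsum R (\<lambda>M. q M \<otimes> monomial_eval R M x) S"
  unfolding indexed_poly_eval_def
  using assms monomial_eval_closed[OF x] indexed_pset_coeff[OF q]
  by (intro add.finprod_mono_neutral_cong_left) auto

lemma indexed_poly_eval_closed:
  assumes "x \<in> I \<rightarrow> carrier R" "q \<in> indexed_pset I (carrier R)"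
  shows "indexed_poly_eval R q x \<in> carrier R"
  unfolding indexed_poly_eval_def
  using monomial_eval_closed[OF assms(1)] indexed_pset_coeff[OF assms(2)]
    indexed_pset_support(2)[OF assms(2)]
  by (intro finsum_closed) auto

lemma indexed_poly_eval_const:
  assumes "x \<in> I \<rightarrow> carrier R" "k \<in> carrier R"
  shows "indexed_poly_eval R (indexed_const k) x = k"
proof -
  have "indexed_poly_eval R (indexed_const k) x
      = finsum R (\<lambda>M. indexed_const k M \<otimes> monomial_eval R M x) {{#}}"
    using assms by (intro indexed_poly_eval_superset indexed_pset.indexed_const)
      (auto simp: indexed_const_def)
  then show ?thesis
    using assms by (simp add: indexed_const_def monomial_eval_def)
qed

lemma indexed_poly_eval_padd:
  assumes x: "x \<in> I \<rightarrow> carrier R"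
    and P: "P \<in> indexed_pset I (carrier R)" and Q: "Q \<in> indexed_pset I (carrier R)"
  shows "indexed_poly_eval R (indexed_padd P Q) x
    = indexed_poly_eval R P x \<oplus> indexed_poly_eval R Q x"
proof -
  let ?S = "{M. P M \<noteq> \<zero>} \<union> {M. Q M \<noteq> \<zero>}"
  have S: "finite ?S" "\<And>M. M \<in> ?S \<Longrightarrow> set_mset M \<subseteq> I"
    using indexed_pset_support[OF P] indexed_pset_support[OF Q] by auto
  note c = indexed_pset_coeff[OF P] indexed_pset_coeff[OF Q]
    monomial_eval_closed[OF x S(2)]
  have "indexed_poly_eval R (indexed_padd P Q) x
      = finsum R (\<lambda>M. indexed_padd P Q M \<otimes> monomial_eval R M x) ?S"
    by (intro indexed_poly_eval_superset[OF x indexed_pset.indexed_padd[OF P Q] S(1) _ S(2)])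
      (auto simp: indexed_padd_def)
  also have "\<dots> = finsum R (\<lambda>M. P M \<otimes> monomial_eval R M x \<oplus> Q M \<otimes> monomial_eval R M x) ?S"
    using c by (intro finsum_cong') (auto simp: indexed_padd_def l_distr)
  also have "\<dots> = finsum R (\<lambda>M. P M \<otimes> monomial_eval R M x) ?S
      \<oplus> finsum R (\<lambda>M. Q M \<otimes> monomial_eval R M x) ?S"
    using c by (intro finsum_addf) auto
  also have "\<dots> = indexed_poly_eval R P x \<oplus> indexed_poly_eval R Q x"
    using indexed_poly_eval_superset[OF x P S(1) _ S(2)]
      indexed_poly_eval_superset[OF x Q S(1) _ S(2)] by simp
  finally show ?thesis .
qed

lemma indexed_poly_eval_pmult:
  assumes x: "x \<in> I \<rightarrow> carrier R" and P: "P \<in> indexed_pset I (carrier R)" and i: "i \<in> I"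
  shows "indexed_poly_eval R (indexed_pmult P i) x = indexed_poly_eval R P x \<otimes> x i"
proof -
  \<comment> \<open>Multiplication by the indeterminate \<open>i\<close> shifts the support by \<open>add_mset i\<close>, which is injective, so
    the two sums correspond term by term.\<close>
  let ?S = "{M. P M \<noteq> \<zero>}"
  have S: "finite ?S" "\<And>M. M \<in> ?S \<Longrightarrow> set_mset M \<subseteq> I"
    using indexed_pset_support[OF P] by auto
  note c = indexed_pset_coeff[OF P] monomial_eval_closed[OF x S(2)]
  have xi: "x i \<in> carrier R"
    using x i by auto
  have supp: "{M. indexed_pmult P i M \<noteq> \<zero>} = add_mset i ` ?S"
  proof (intro equalityI subsetI)
    fix M assume "M \<in> {M. indexed_pmult P i M \<noteq> \<zero>}"
    then have "i \<in># M" "P (M - {#i#}) \<noteq> \<zero>"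
      by (auto simp: indexed_pmult_def split: if_splits)
    then show "M \<in> add_mset i ` ?S"
      by (intro image_eqI[of _ _ "M - {#i#}"]) auto
  qed (auto simp: indexed_pmult_def)
  have "indexed_poly_eval R (indexed_pmult P i) x
      = finsum R (\<lambda>M. indexed_pmult P i M \<otimes> monomial_eval R M x) (add_mset i ` ?S)"
    by (simp add: indexed_poly_eval_def supp)
  also have "\<dots> = finsum R (\<lambda>M. indexed_pmult P i (add_mset i M) \<otimes> monomial_eval R (add_mset i M) x) ?S"
    using c xi S i
    by (intro finsum_reindex)
      (auto simp: indexed_pmult_def inj_on_def monomial_eval_add_mset[OF x])
  also have "\<dots> = finsum R (\<lambda>M. P M \<otimes> monomial_eval R M x \<otimes> x i) ?S"
    using c xi S i
    by (intro finsum_cong') (auto simp: indexed_pmult_def monomial_eval_add_mset[OF x] m_assoc)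
  also have "\<dots> = indexed_poly_eval R P x \<otimes> x i"
    unfolding indexed_poly_eval_def using c xi S(1) by (intro finsum_ldistr[symmetric]) auto
  finally show ?thesis .
qed

section \<open>Closure properties of polyfunctions\<close>

lemma affine_point_Pi: "x \<in> affine_points R d \<Longrightarrow> x \<in> {..<d} \<rightarrow> carrier R"
  by (auto simp: affine_points_def)

lemma eval_in_polyfun_ring:
  assumes "q \<in> indexed_pset {..<d} (carrier R)"
    and "\<And>x. x \<in> affine_points R d \<Longrightarrow> F x = indexed_poly_eval R q x"
  shows "(\<lambda>x\<in>affine_points R d. F x) \<in> carrier (polyfun_ring R d)"
proof -
  have "F x \<in> carrier R" if "x \<in> affine_points R d" for x
    using assms(2)[OF that] indexed_poly_eval_closed[OF affine_point_Pi[OF that] assms(1)] by simp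
  then have "(\<lambda>x\<in>affine_points R d. F x) \<in> affine_points R d \<rightarrow>\<^sub>E carrier R"
    by auto
  moreover have "\<exists>q\<in>indexed_pset {..<d} (carrier R).
      \<forall>x\<in>affine_points R d. (\<lambda>x\<in>affine_points R d. F x) x = indexed_poly_eval R q x"
    using assms by (intro bexI[of _ q]) simp_all
  ultimately show ?thesis
    by (simp add: polyfun_ring_def)
qed

lemma polyfun_const:
  assumes "k \<in> carrier R"
  shows "(\<lambda>x\<in>affine_points R d. k) \<in> carrier (polyfun_ring R d)"
  using assms indexed_poly_eval_const[OF affine_point_Pi]
  by (intro eval_in_polyfun_ring[of "indexed_const k"] indexed_pset.indexed_const) auto

lemma polyfun_add:
  assumes "f \<in> carrier (polyfun_ring R d)" "g \<in> carrier (polyfun_ring R d)"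
  shows "(\<lambda>x\<in>affine_points R d. f x \<oplus> g x) \<in> carrier (polyfun_ring R d)"
proof -
  obtain P Q where
    "P \<in> indexed_pset {..<d} (carrier R)" "\<forall>x\<in>affine_points R d. f x = indexed_poly_eval R P x"
    "Q \<in> indexed_pset {..<d} (carrier R)" "\<forall>x\<in>affine_points R d. g x = indexed_poly_eval R Q x"
    using assms by (auto simp: polyfun_ring_def)
  then show ?thesis
    using indexed_poly_eval_padd[OF affine_point_Pi]
    by (intro eval_in_polyfun_ring[of "indexed_padd P Q"] indexed_pset.indexed_padd) auto
qed

lemma polyfun_mult_coord:
  assumes "f \<in> carrier (polyfun_ring R d)" "i < d"
  shows "(\<lambda>x\<in>affine_points R d. f x \<otimes> x i) \<in> carrier (polyfun_ring R d)"
proof -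
  obtain P where
    "P \<in> indexed_pset {..<d} (carrier R)" "\<forall>x\<in>affine_points R d. f x = indexed_poly_eval R P x"
    using assms by (auto simp: polyfun_ring_def)
  then show ?thesis
    using assms indexed_poly_eval_pmult[OF affine_point_Pi]
    by (intro eval_in_polyfun_ring[of "indexed_pmult P i"] indexed_pset.indexed_pmult) auto
qed

lemma polyfun_value_closed:
  "f \<in> carrier (polyfun_ring R d) \<Longrightarrow> x \<in> affine_points R d \<Longrightarrow> f x \<in> carrier R"
  by (auto simp: polyfun_ring_def)

text \<open>Polyfunctions inherit the inductive generation of indexed polynomials; closure under
  products and reduction modulo a divisor are both obtained by this induction rather than by
  manipulating coefficients.\<close>

lemma polyfun_induct [consumes 1, case_names const add mult_coord]:
  assumes f: "f \<in> carrier (polyfun_ring R d)"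
    and const: "\<And>k. k \<in> carrier R \<Longrightarrow> P (\<lambda>x\<in>affine_points R d. k)"
    and add: "\<And>f g. f \<in> carrier (polyfun_ring R d) \<Longrightarrow> g \<in> carrier (polyfun_ring R d) \<Longrightarrow>
      P f \<Longrightarrow> P g \<Longrightarrow> P (\<lambda>x\<in>affine_points R d. f x \<oplus> g x)"
    and coord: "\<And>f i. f \<in> carrier (polyfun_ring R d) \<Longrightarrow> P f \<Longrightarrow> i < d \<Longrightarrow>
      P (\<lambda>x\<in>affine_points R d. f x \<otimes> x i)"
  shows "P f"
proof -
  let ?fun = "\<lambda>q. \<lambda>x\<in>affine_points R d. indexed_poly_eval R q x"
  have "?fun q \<in> carrier (polyfun_ring R d) \<and> P (?fun q)"
    if "q \<in> indexed_pset {..<d} (carrier R)" for q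
    using that
  proof induction
    case (indexed_const k)
    then have eq: "?fun (ring.indexed_const R k) = (\<lambda>x\<in>affine_points R d. k)"
      by (intro restrict_ext) (rule indexed_poly_eval_const[OF affine_point_Pi])
    show ?case
      unfolding eq using indexed_const by (intro conjI polyfun_const const)
  next
    case (indexed_padd p q)
    then have eq: "?fun (indexed_padd p q) = (\<lambda>x\<in>affine_points R d. ?fun p x \<oplus> ?fun q x)"
      by (intro restrict_ext) (simp add: indexed_poly_eval_padd[OF affine_point_Pi])
    show ?case
      unfolding eq using indexed_padd.IH
      by (intro conjI polyfun_add add) (elim conjE, assumption)+
  next
    case (indexed_pmult p i)
    then have eq: "?fun (indexed_pmult p i) = (\<lambda>x\<in>affine_points R d. ?fun p x \<otimes> x i)"
      by (intro restrict_ext) (simp add: indexed_poly_eval_pmult[OF affine_point_Pi])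
    have "i < d"
      using indexed_pmult.hyps by simp
    then show ?case
      unfolding eq using indexed_pmult.IH
      by (intro conjI polyfun_mult_coord coord) (elim conjE, assumption)+
  qed
  moreover obtain q where q: "q \<in> indexed_pset {..<d} (carrier R)"
    "\<forall>x\<in>affine_points R d. f x = indexed_poly_eval R q x"
    using f by (auto simp: polyfun_ring_def)
  moreover have "f = ?fun q"
    using f q(2) by (intro extensionalityI[of _ "affine_points R d"])
      (auto simp: polyfun_ring_def PiE_def)
  ultimately show ?thesis by (metis (no_types))
qed

text \<open>Induction on \<open>g\<close> reduces a product to sums, to multiplication by a coordinate, and to
  multiplication of \<open>f\<close> by a constant; the last is an induction on \<open>f\<close>. The product of two indexed
  polynomials never has to be formed.\<close>

lemma polyfun_mult:
  assumes f: "f \<in> carrier (polyfun_ring R d)" and g: "g \<in> carrier (polyfun_ring R d)"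
  shows "(\<lambda>x\<in>affine_points R d. f x \<otimes> g x) \<in> carrier (polyfun_ring R d)"
proof -
  have scale: "(\<lambda>x\<in>affine_points R d. f x \<otimes> k) \<in> carrier (polyfun_ring R d)"
    if k: "k \<in> carrier R" for k
    using f
  proof (induction rule: polyfun_induct)
    case (const c)
    have "(\<lambda>x\<in>affine_points R d. (\<lambda>x\<in>affine_points R d. c) x \<otimes> k) = (\<lambda>x\<in>affine_points R d. c \<otimes> k)"
      by auto
    with polyfun_const[of "c \<otimes> k"] const k show ?case by (metis m_closed)
  next
    case (add f g)
    have "(\<lambda>x\<in>affine_points R d. (\<lambda>x\<in>affine_points R d. f x \<oplus> g x) x \<otimes> k) =
      (\<lambda>x\<in>affine_points R d. (\<lambda>x\<in>affine_points R d. f x \<otimes> k) x \<oplus> (\<lambda>x\<in>affine_points R d. g x \<otimes> k) x)"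
      using add polyfun_value_closed k by (intro restrict_ext) (auto simp: l_distr)
    with polyfun_add[OF add.IH] show ?case by (simp only:)
  next
    case (mult_coord f i)
    have "(\<lambda>x\<in>affine_points R d. (\<lambda>x\<in>affine_points R d. f x \<otimes> x i) x \<otimes> k) =
      (\<lambda>x\<in>affine_points R d. (\<lambda>x\<in>affine_points R d. f x \<otimes> k) x \<otimes> x i)"
    proof (intro restrict_ext)
      fix x assume x: "x \<in> affine_points R d"
      then have "x i \<in> carrier R" "f x \<in> carrier R"
        using mult_coord affine_point_Pi[OF x] polyfun_value_closed by auto
      with x k show "(\<lambda>x\<in>affine_points R d. f x \<otimes> x i) x \<otimes> k
          = (\<lambda>x\<in>affine_points R d. f x \<otimes> k) x \<otimes> x i"
        by (simp add: m_ac)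
    qed
    with polyfun_mult_coord[OF mult_coord.IH mult_coord.hyps(2)] show ?case by (simp only:)
  qed
  show ?thesis
    using g
  proof (induction rule: polyfun_induct)
    case (const c)
    have "(\<lambda>x\<in>affine_points R d. f x \<otimes> (\<lambda>x\<in>affine_points R d. c) x) = (\<lambda>x\<in>affine_points R d. f x \<otimes> c)"
      by auto
    with scale[OF const] show ?case by (simp only:)
  next
    case (add g h)
    have "(\<lambda>x\<in>affine_points R d. f x \<otimes> (\<lambda>x\<in>affine_points R d. g x \<oplus> h x) x) =
      (\<lambda>x\<in>affine_points R d. (\<lambda>x\<in>affine_points R d. f x \<otimes> g x) x \<oplus> (\<lambda>x\<in>affine_points R d. f x \<otimes> h x) x)"
      using add polyfun_value_closed f by (intro restrict_ext) (auto simp: r_distr)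
    with polyfun_add[OF add.IH] show ?case by (simp only:)
  next
    case (mult_coord g i)
    have "(\<lambda>x\<in>affine_points R d. f x \<otimes> (\<lambda>x\<in>affine_points R d. g x \<otimes> x i) x) =
      (\<lambda>x\<in>affine_points R d. (\<lambda>x\<in>affine_points R d. f x \<otimes> g x) x \<otimes> x i)"
    proof (intro restrict_ext)
      fix x assume x: "x \<in> affine_points R d"
      then have "x i \<in> carrier R" "f x \<in> carrier R" "g x \<in> carrier R"
        using mult_coord affine_point_Pi[OF x] polyfun_value_closed f by auto
      with x show "f x \<otimes> (\<lambda>x\<in>affine_points R d. g x \<otimes> x i) x
          = (\<lambda>x\<in>affine_points R d. f x \<otimes> g x) x \<otimes> x i"
        by (simp add: m_ac)
    qed
    with polyfun_mult_coord[OF mult_coord.IH mult_coord.hyps(2)] show ?case by (simp only:)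
  qed
qed

end

section \<open>Polyfunctions over residue rings\<close>

abbreviation residue_points :: "int \<Rightarrow> nat \<Rightarrow> (nat \<Rightarrow> int) set" where
  "residue_points n d \<equiv> affine_points (residue_ring n) d"

abbreviation residue_polyfuns :: "int \<Rightarrow> nat \<Rightarrow> ((nat \<Rightarrow> int) \<Rightarrow> int) set" where
  "residue_polyfuns n d \<equiv> carrier (polyfun_ring (residue_ring n) d)"

text \<open>Formulas in ordinary integer arithmetic are easier to handle than iterated operations of
  \<open>residue_ring n\<close>. This predicate says that such a formula, reduced modulo \<open>n\<close> at the end, is a
  polyfunction.\<close>

definition int_polyfun :: "int \<Rightarrow> nat \<Rightarrow> ((nat \<Rightarrow> int) \<Rightarrow> int) \<Rightarrow> bool" where
  "int_polyfun n d F \<longleftrightarrow> (\<lambda>x\<in>residue_points n d. F x mod n) \<in> residue_polyfuns n d"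

lemma carrier_residue_ring: "carrier (residue_ring n) = {0..<n}"
  by (auto simp: residue_ring_def)

lemma residue_points_eq: "residue_points n d = {..<d} \<rightarrow>\<^sub>E {0..<n}"
  by (simp only: affine_points_def carrier_residue_ring)

lemma residue_polyfuns_subset: "residue_polyfuns n d \<subseteq> residue_points n d \<rightarrow>\<^sub>E {0..<n}"
  by (simp add: polyfun_ring_def carrier_residue_ring Collect_conj_eq)

lemma finite_residue_polyfuns: "finite (residue_polyfuns n d)"
  by (rule finite_subset[OF residue_polyfuns_subset])
    (auto simp: residue_points_eq intro!: finite_PiE)

lemma residue_polyfun_value:
  "f \<in> residue_polyfuns n d \<Longrightarrow> x \<in> residue_points n d \<Longrightarrow> f x \<in> {0..<n}"
  using residue_polyfuns_subset by blast

context
  fixes n :: int and d :: nat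
  assumes n: "n > 1"
begin

interpretation residues n "residue_ring n"
  by unfold_locales (use n in auto)

interpretation cring "residue_ring n"
  by (rule cring)

lemma int_polyfun_polyfun:
  assumes f: "f \<in> residue_polyfuns n d"
  shows "int_polyfun n d f"
proof -
  have "(\<lambda>x\<in>residue_points n d. f x mod n) = f"
  proof (rule extensionalityI[of _ "residue_points n d"])
    show "f \<in> extensional (residue_points n d)"
      using f residue_polyfuns_subset by (meson PiE_iff subsetD)
    show "(\<lambda>x\<in>residue_points n d. f x mod n) x = f x" if "x \<in> residue_points n d" for x
      using that residue_polyfun_value[OF f that] by simp
  qed simp
  with f show ?thesis by (simp add: int_polyfun_def)
qed

lemma int_polyfun_const: "int_polyfun n d (\<lambda>_. k)"
  unfolding int_polyfun_def using n by (intro polyfun_const) (simp add: carrier_residue_ring)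

lemma int_polyfun_add:
  assumes "int_polyfun n d F" "int_polyfun n d G"
  shows "int_polyfun n d (\<lambda>x. F x + G x)"
proof -
  have eq: "(\<lambda>x\<in>residue_points n d. (F x + G x) mod n)
    = (\<lambda>x\<in>residue_points n d. (\<lambda>x\<in>residue_points n d. F x mod n) x
      \<oplus>\<^bsub>residue_ring n\<^esub> (\<lambda>x\<in>residue_points n d. G x mod n) x)"
    by (intro restrict_ext) (simp add: residue_ring_def mod_simps)
  show ?thesis
    unfolding int_polyfun_def eq by (intro polyfun_add assms[unfolded int_polyfun_def])
qed

lemma int_polyfun_mult:
  assumes "int_polyfun n d F" "int_polyfun n d G"
  shows "int_polyfun n d (\<lambda>x. F x * G x)"
proof -
  have eq: "(\<lambda>x\<in>residue_points n d. (F x * G x) mod n)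
    = (\<lambda>x\<in>residue_points n d. (\<lambda>x\<in>residue_points n d. F x mod n) x
      \<otimes>\<^bsub>residue_ring n\<^esub> (\<lambda>x\<in>residue_points n d. G x mod n) x)"
    by (intro restrict_ext) (simp add: residue_ring_def mod_simps)
  show ?thesis
    unfolding int_polyfun_def eq by (intro polyfun_mult assms[unfolded int_polyfun_def])
qed

lemma int_polyfun_coord:
  assumes "i < d"
  shows "int_polyfun n d (\<lambda>x. x i)"
proof -
  have eq: "(\<lambda>x\<in>residue_points n d. x i mod n)
    = (\<lambda>x\<in>residue_points n d. (\<lambda>x\<in>residue_points n d. 1 mod n) x \<otimes>\<^bsub>residue_ring n\<^esub> x i)"
    using n by (intro restrict_ext) (simp add: residue_ring_def)
  show ?thesis
    unfolding int_polyfun_def eq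
    by (intro polyfun_mult_coord assms int_polyfun_const[unfolded int_polyfun_def])
qed

lemma int_polyfun_diff:
  assumes "int_polyfun n d F" "int_polyfun n d G"
  shows "int_polyfun n d (\<lambda>x. F x - G x)"
  using int_polyfun_add[OF assms(1) int_polyfun_mult[OF int_polyfun_const[of "-1"] assms(2)]]
  by simp

lemma int_polyfun_power: "int_polyfun n d F \<Longrightarrow> int_polyfun n d (\<lambda>x. F x ^ k)"
  by (induction k) (simp_all add: int_polyfun_const int_polyfun_mult)

lemma int_polyfun_sum:
  assumes "\<And>a. a \<in> A \<Longrightarrow> int_polyfun n d (F a)"
  shows "int_polyfun n d (\<lambda>x. \<Sum>a\<in>A. F a x)"
  using assms
  by (induction A rule: infinite_finite_induct) (simp_all add: int_polyfun_const int_polyfun_add)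

lemma int_polyfun_prod:
  assumes "\<And>a. a \<in> A \<Longrightarrow> int_polyfun n d (F a)"
  shows "int_polyfun n d (\<lambda>x. \<Prod>a\<in>A. F a x)"
  using assms
  by (induction A rule: infinite_finite_induct) (simp_all add: int_polyfun_const int_polyfun_mult)

text \<open>Polynomials respect congruences modulo every divisor of the modulus, since the ring operations
  do.\<close>

lemma polyfun_cong:
  assumes "k dvd n" "f \<in> residue_polyfuns n d"
    and "x \<in> residue_points n d" "y \<in> residue_points n d"
    and "\<And>i. i < d \<Longrightarrow> [x i = y i] (mod k)"
  shows "[f x = f y] (mod k)"
  using assms(2)
proof (induction rule: polyfun_induct)
  case (const c)
  with assms show ?case by simp
next
  case (add f g)
  with assms show ?case
    by (simp add: residue_ring_def cong_def mod_mod_cancel)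
      (metis mod_add_eq)
next
  case (mult_coord f i)
  with assms show ?case
    by (simp add: residue_ring_def cong_def mod_mod_cancel)
      (metis mod_mult_eq)
qed

text \<open>A polyfunction whose values are all invertible has an inverse among all functions, and the
  question is why that inverse is a polyfunction: by Euler's theorem it is the power of \<open>f\<close> with
  exponent \<open>totient n - 1\<close>.\<close>

lemma Units_residue_polyfuns:
  "Units (polyfun_ring (residue_ring n) d) =
    {f \<in> residue_polyfuns n d. \<forall>x\<in>residue_points n d. coprime (f x) n}"
proof (intro equalityI subsetI CollectI conjI ballI)
  fix f assume f: "f \<in> Units (polyfun_ring (residue_ring n) d)"
  then show "f \<in> residue_polyfuns n d"
    by (simp add: Units_def)
  fix x assume x: "x \<in> residue_points n d"
  from f obtain g where
    "f \<otimes>\<^bsub>polyfun_ring (residue_ring n) d\<^esub> g = \<one>\<^bsub>polyfun_ring (residue_ring n) d\<^esub>"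
    by (auto simp: Units_def)
  then have "(f \<otimes>\<^bsub>polyfun_ring (residue_ring n) d\<^esub> g) x = \<one>\<^bsub>polyfun_ring (residue_ring n) d\<^esub> x"
    by simp
  then have "(f x * g x) mod n = 1"
    using x by (simp add: polyfun_ring_def residue_ring_def)
  then have "[f x * g x = 1] (mod n)"
    using n by (simp add: cong_def)
  then show "coprime (f x) n"
    using coprime_iff_invertible_int by blast
next
  fix f assume "f \<in> {f \<in> residue_polyfuns n d. \<forall>x\<in>residue_points n d. coprime (f x) n}"
  then have f: "f \<in> residue_polyfuns n d"
    and cop: "\<And>x. x \<in> residue_points n d \<Longrightarrow> coprime (f x) n" by auto
  define t where "t = totient (nat n)"
  have t: "t > 0" using n by (simp add: t_def)
  define g where "g = (\<lambda>x\<in>residue_points n d. f x ^ (t - 1) mod n)"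
  have g: "g \<in> residue_polyfuns n d"
    using int_polyfun_power[OF int_polyfun_polyfun[OF f]] by (simp add: g_def int_polyfun_def)
  have inv: "(f x * g x) mod n = 1" if x: "x \<in> residue_points n d" for x
  proof -
    have "(f x * g x) mod n = f x ^ t mod n"
      using x power_minus_mult[OF t, of "f x"] by (simp add: g_def mod_simps mult.commute)
    also have "\<dots> = 1"
      using euler_theorem[OF cop[OF x]] n by (simp add: t_def cong_def)
    finally show ?thesis .
  qed
  let ?G = "polyfun_ring (residue_ring n) d"
  have "f \<otimes>\<^bsub>?G\<^esub> g = (\<lambda>x\<in>residue_points n d. (f x * g x) mod n)"
    by (simp add: polyfun_ring_def residue_ring_def)
  also have "\<dots> = (\<lambda>x\<in>residue_points n d. 1)"
    using inv by (intro restrict_ext) simp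
  also have "\<dots> = \<one>\<^bsub>?G\<^esub>"
    by (simp add: polyfun_ring_def residue_ring_def)
  finally have fg: "f \<otimes>\<^bsub>?G\<^esub> g = \<one>\<^bsub>?G\<^esub>" .
  moreover have "g \<otimes>\<^bsub>?G\<^esub> f = f \<otimes>\<^bsub>?G\<^esub> g"
    by (simp add: polyfun_ring_def residue_ring_def mult.commute)
  ultimately show "f \<in> Units ?G"
    unfolding Units_def using f g by auto
qed

end

section \<open>Reduction modulo a prime\<close>

text \<open>The canonical representatives \<open>{0..<p}\<close> are among those for every multiple \<open>n\<close> of \<open>p\<close>, so the
  induced function on \<open>\<int>\<^sub>p\<^sup>d\<close> is obtained by restricting \<open>f\<close> to the points with such coordinates.\<close>

definition reduce_polyfun :: "int \<Rightarrow> nat \<Rightarrow> ((nat \<Rightarrow> int) \<Rightarrow> int) \<Rightarrow> ((nat \<Rightarrow> int) \<Rightarrow> int)" where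
  "reduce_polyfun p d f = (\<lambda>y\<in>residue_points p d. f y mod p)"

lemma fermat_indicator:
  fixes p u v :: int
  assumes p: "prime p" and u: "u \<in> {0..<p}" and v: "v \<in> {0..<p}"
  shows "[1 - (u - v) ^ (nat p - 1) = (if u = v then 1 else 0)] (mod p)"
proof (cases "u = v")
  case True
  have "nat p - 1 \<noteq> 0" using prime_gt_1_int[OF p] by simp
  with True show ?thesis by (simp only: power_0_left diff_self) simp
next
  case False
  have "\<not> p dvd u - v"
  proof
    assume "p dvd u - v"
    then have "[u = v] (mod p)" by (simp add: cong_iff_dvd_diff)
    with u v have "u = v" by (simp add: cong_def)
    with False show False ..
  qed
  then have "coprime (u - v) p"
    using p by (simp add: prime_imp_coprime coprime_commute)
  then have "[(u - v) ^ (nat p - 1) = 1] (mod p)"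
    using residues.euler_theorem[of p "u - v"] p prime_gt_1_int[OF p]
    by (simp add: residues_def totient_prime)
  then have "[1 - (u - v) ^ (nat p - 1) = 1 - 1] (mod p)"
    by (intro cong_diff) auto
  with False show ?thesis by simp
qed

lemma residue_points_mono: "p \<le> n \<Longrightarrow> residue_points p d \<subseteq> residue_points n d"
  unfolding residue_points_eq by (intro PiE_mono) simp

lemma reduce_polyfun_in:
  "p > 0 \<Longrightarrow> reduce_polyfun p d f \<in> residue_points p d \<rightarrow>\<^sub>E {0..<p}"
  unfolding reduce_polyfun_def by (intro restrict_PiE[THEN iffD2] funcsetI) simp

text \<open>Lagrange interpolation over \<open>\<int>\<^sub>p\<close>: by \<open>fermat_indicator\<close> the polynomial \<open>e a\<close> is the
  indicator of the point \<open>a\<close> modulo \<open>p\<close>, and \<open>\<Sum>a. h a * e a\<close>, read modulo \<open>n\<close>, reduces to \<open>h\<close>.\<close>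

lemma reduce_polyfun_surj:
  assumes p: "prime p" and n: "n > 1" and pn: "p dvd n"
    and h: "h \<in> residue_points p d \<rightarrow>\<^sub>E {0..<p}"
  shows "\<exists>g\<in>residue_polyfuns n d. reduce_polyfun p d g = h"
proof -
  let ?B = "residue_points p d"
  define e where "e a x = (\<Prod>i<d. 1 - (x i - a i) ^ (nat p - 1))" for a x :: "nat \<Rightarrow> int"
  define F where "F x = (\<Sum>a\<in>?B. h a * e a x)" for x
  have finB: "finite ?B"
    by (auto simp: residue_points_eq intro: finite_PiE)
  have e: "[e a y = (if a = y then 1 else 0)] (mod p)" if a: "a \<in> ?B" and y: "y \<in> ?B" for a y
  proof -
    have "[e a y = (\<Prod>i<d. if y i = a i then 1 else 0)] (mod p)"
      unfolding e_def
    proof (rule cong_prod)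
      fix i assume "i \<in> {..<d}"
      then have "y i \<in> {0..<p}" "a i \<in> {0..<p}"
        using a y unfolding residue_points_eq by (blast dest: PiE_mem)+
      then show "[1 - (y i - a i) ^ (nat p - 1) = (if y i = a i then 1 else 0)] (mod p)"
        by (rule fermat_indicator[OF p])
    qed
    also have "(\<Prod>i<d. if y i = a i then 1 else 0) = (if a = y then 1 else 0 :: int)"
    proof (cases "a = y")
      case False
      have "\<exists>i\<in>{..<d}. y i \<noteq> a i"
        using PiE_ext[OF a[unfolded residue_points_eq] y[unfolded residue_points_eq]] False
        by metis
      then have "(\<Prod>i<d. if y i = a i then 1 else 0 :: int) = 0"
        by (intro prod_zero) auto
      with False show ?thesis by simp
    qed simp
    finally show ?thesis .
  qed
  have F: "F y mod p = h y" if y: "y \<in> ?B" for y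
  proof -
    have "[F y = (\<Sum>a\<in>?B. h a * (if a = y then 1 else 0))] (mod p)"
      unfolding F_def by (intro cong_sum cong_mult cong_refl e y)
    also have "(\<Sum>a\<in>?B. h a * (if a = y then 1 else 0)) = (\<Sum>a\<in>?B. if a = y then h a else 0)"
      by (intro sum.cong) auto
    also have "\<dots> = h y"
      using y finB by simp
    finally show ?thesis
      using PiE_mem[OF h y] by (simp add: cong_def)
  qed
  have "int_polyfun n d (\<lambda>x. \<Sum>a\<in>?B. h a * (\<Prod>i<d. 1 - (x i - a i) ^ (nat p - 1)))"
    by (intro int_polyfun_sum[OF n] int_polyfun_mult[OF n] int_polyfun_prod[OF n]
        int_polyfun_diff[OF n] int_polyfun_power[OF n] int_polyfun_const[OF n]
        int_polyfun_coord[OF n]) simp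
  then have "int_polyfun n d F"
    by (simp only: F_def[abs_def] e_def)
  then have "(\<lambda>x\<in>residue_points n d. F x mod n) \<in> residue_polyfuns n d"
    by (simp only: int_polyfun_def)
  moreover have "reduce_polyfun p d (\<lambda>x\<in>residue_points n d. F x mod n) = h"
  proof (rule PiE_ext[OF reduce_polyfun_in[OF prime_gt_0_int[OF p]] h])
    fix y assume y: "y \<in> ?B"
    have "p \<le> n" using pn n by (auto intro: zdvd_imp_le)
    then have "y \<in> residue_points n d"
      using y residue_points_mono by blast
    with y show "reduce_polyfun p d (\<lambda>x\<in>residue_points n d. F x mod n) y = h y"
      using F[OF y] by (simp add: reduce_polyfun_def mod_mod_cancel[OF pn])
  qed
  ultimately show ?thesis by blast
qed

text \<open>Adding a polyfunction with reduction \<open>h' - h\<close> is an injection of the fibre over \<open>h\<close> into the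
  fibre over \<open>h'\<close>. As \<open>h\<close> and \<open>h'\<close> are arbitrary, all fibres have the same size.\<close>

lemma card_reduce_fibre_le:
  assumes p: "prime p" and n: "n > 1" and pn: "p dvd n"
    and h: "h \<in> residue_points p d \<rightarrow>\<^sub>E {0..<p}" and h': "h' \<in> residue_points p d \<rightarrow>\<^sub>E {0..<p}"
  shows "card {f \<in> residue_polyfuns n d. reduce_polyfun p d f = h}
    \<le> card {f \<in> residue_polyfuns n d. reduce_polyfun p d f = h'}"
proof -
  have p0: "p > 0" using p prime_gt_0_int by blast
  have "(\<lambda>y\<in>residue_points p d. (h' y - h y) mod p) \<in> residue_points p d \<rightarrow>\<^sub>E {0..<p}"
    using p0 by auto
  then obtain g where g: "g \<in> residue_polyfuns n d"
    and gh: "reduce_polyfun p d g = (\<lambda>y\<in>residue_points p d. (h' y - h y) mod p)"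
    using reduce_polyfun_surj[OF p n pn] by blast
  define T where "T f = (\<lambda>x\<in>residue_points n d. (f x + g x) mod n)" for f
  have pn_le: "p \<le> n" using pn n by (auto intro: zdvd_imp_le)
  have "inj_on T (residue_polyfuns n d)"
  proof (rule inj_onI)
    fix f f' assume f: "f \<in> residue_polyfuns n d" and f': "f' \<in> residue_polyfuns n d" and eq: "T f = T f'"
    show "f = f'"
    proof (rule PiE_ext)
      show "f \<in> residue_points n d \<rightarrow>\<^sub>E {0..<n}" "f' \<in> residue_points n d \<rightarrow>\<^sub>E {0..<n}"
        using f f' residue_polyfuns_subset by blast+
      fix x assume x: "x \<in> residue_points n d"
      from fun_cong[OF eq, of x] x have "[f x + g x = f' x + g x] (mod n)"
        by (simp add: T_def cong_def)
      then have "[f x = f' x] (mod n)"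
        by (simp add: cong_add_rcancel)
      then show "f x = f' x"
        using residue_polyfun_value[OF f x] residue_polyfun_value[OF f' x] by (simp add: cong_def)
    qed
  qed
  moreover have "T f \<in> residue_polyfuns n d \<and> reduce_polyfun p d (T f) = h'"
    if f: "f \<in> residue_polyfuns n d" and fh: "reduce_polyfun p d f = h" for f
  proof
    show "T f \<in> residue_polyfuns n d"
      using int_polyfun_add[OF n int_polyfun_polyfun[OF n f] int_polyfun_polyfun[OF n g]]
      by (simp add: T_def int_polyfun_def)
    show "reduce_polyfun p d (T f) = h'"
    proof (rule PiE_ext[OF reduce_polyfun_in[OF p0] h'])
      fix y assume y: "y \<in> residue_points p d"
      then have y': "y \<in> residue_points n d"
        using residue_points_mono[OF pn_le] by blast
      have "f y mod p = h y" "g y mod p = (h' y - h y) mod p"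
        using fun_cong[OF fh, of y] fun_cong[OF gh, of y] y by (simp_all add: reduce_polyfun_def)
      then have "(f y + g y) mod p = (h y + (h' y - h y)) mod p"
        by (metis mod_add_eq mod_add_right_eq)
      also have "\<dots> = h' y" using PiE_mem[OF h' y] by simp
      finally show "reduce_polyfun p d (T f) y = h' y"
        using y y' by (simp add: reduce_polyfun_def T_def mod_mod_cancel[OF pn])
    qed
  qed
  ultimately show ?thesis
    by (intro card_inj_on_le[of T])
      (auto simp: finite_residue_polyfuns intro: inj_on_subset)
qed

lemma card_reduce_preimage:
  assumes p: "prime p" and n: "n > 1" and pn: "p dvd n"
    and S: "S \<subseteq> residue_points p d \<rightarrow>\<^sub>E {0..<p}"
  shows "card {f \<in> residue_polyfuns n d. reduce_polyfun p d f \<in> S}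
    = card S * card {f \<in> residue_polyfuns n d. reduce_polyfun p d f = (\<lambda>y\<in>residue_points p d. 0)}"
    (is "_ = _ * ?K")
proof -
  let ?A = "\<lambda>h. {f \<in> residue_polyfuns n d. reduce_polyfun p d f = h}"
  have p0: "p > 0" using p prime_gt_0_int by blast
  have zero: "(\<lambda>y\<in>residue_points p d. 0) \<in> residue_points p d \<rightarrow>\<^sub>E {0..<p}"
    using p0 by auto
  have "finite (residue_points p d \<rightarrow>\<^sub>E {0..<p})"
    by (auto simp: residue_points_eq intro!: finite_PiE)
  with S have finS: "finite S" by (rule finite_subset)
  have "{f \<in> residue_polyfuns n d. reduce_polyfun p d f \<in> S} = (\<Union>h\<in>S. ?A h)"
    by auto
  also have "card \<dots> = (\<Sum>h\<in>S. card (?A h))"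
    using finS finite_residue_polyfuns[of n d] by (intro card_UN_disjoint) auto
  also have "\<dots> = (\<Sum>h\<in>S. ?K)"
    using S zero card_reduce_fibre_le[OF p n pn]
    by (intro sum.cong refl antisym) auto
  finally show ?thesis by simp
qed

lemma card_residue_points: "card (residue_points p d) = nat p ^ d"
  by (simp add: residue_points_eq card_PiE)

text \<open>Being a unit is a condition at all points of \<open>\<int>\<^sub>n\<^sup>d\<close>, but by \<open>polyfun_cong\<close> it suffices to
  check it at their residues modulo \<open>p\<close>, which is what the reduction sees.\<close>

lemma Units_residue_polyfuns_prime_power:
  assumes p: "prime (p :: int)" and m: "m \<ge> 1"
  shows "Units (polyfun_ring (residue_ring (p ^ m)) d) =
    {f \<in> residue_polyfuns (p ^ m) d. reduce_polyfun p d f \<in> residue_points p d \<rightarrow>\<^sub>E {1..<p}}"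
proof -
  have p1: "p > 1" using p prime_gt_1_int by blast
  have n: "p ^ m > 1" using p1 m by (intro one_less_power) auto
  have pn: "p dvd p ^ m" using m by (simp add: dvd_power)
  have le: "p \<le> p ^ m" using pn n by (auto intro: zdvd_imp_le)
  have "(\<forall>x\<in>residue_points (p ^ m) d. coprime (f x) (p ^ m)) \<longleftrightarrow>
      reduce_polyfun p d f \<in> residue_points p d \<rightarrow>\<^sub>E {1..<p}"
    if f: "f \<in> residue_polyfuns (p ^ m) d" for f
  proof -
    have cop: "coprime (f x) (p ^ m) \<longleftrightarrow> f x mod p \<noteq> 0" for x
    proof -
      have "coprime (f x) (p ^ m) \<longleftrightarrow> coprime p (f x)"
        using m by (simp add: coprime_power_right_iff coprime_commute)
      also have "\<dots> \<longleftrightarrow> \<not> p dvd f x"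
        using p prime_imp_coprime[OF p, of "f x"] not_prime_unit[of p] coprime_absorb_left[of p "f x"]
        by blast
      finally show ?thesis by (simp add: dvd_eq_mod_eq_0)
    qed
    have "(\<forall>x\<in>residue_points (p ^ m) d. f x mod p \<noteq> 0) \<longleftrightarrow>
        (\<forall>y\<in>residue_points p d. f y mod p \<noteq> 0)"
    proof
      assume R: "\<forall>y\<in>residue_points p d. f y mod p \<noteq> 0"
      show "\<forall>x\<in>residue_points (p ^ m) d. f x mod p \<noteq> 0"
      proof
        fix x assume x: "x \<in> residue_points (p ^ m) d"
        let ?y = "\<lambda>i\<in>{..<d}. x i mod p"
        have y: "?y \<in> residue_points p d"
          using p1 by (auto simp: residue_points_eq)
        then have "[f x = f ?y] (mod p)"
          using residue_points_mono[OF le]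
          by (intro polyfun_cong[OF n pn f x]) (auto simp: cong_def)
        with R y show "f x mod p \<noteq> 0" by (simp add: cong_def)
      qed
    next
      assume L: "\<forall>x\<in>residue_points (p ^ m) d. f x mod p \<noteq> 0"
      show "\<forall>y\<in>residue_points p d. f y mod p \<noteq> 0"
        using L subsetD[OF residue_points_mono[OF le]] by simp
    qed
    moreover have "f y mod p \<noteq> 0 \<longleftrightarrow> f y mod p \<in> {1..<p}" for y
    proof -
      have "0 \<le> f y mod p" "f y mod p < p"
        using p1 by simp_all
      then show ?thesis by auto
    qed
    ultimately show ?thesis
      using cop by (auto simp: reduce_polyfun_def PiE_iff)
  qed
  then show ?thesis
    unfolding Units_residue_polyfuns[OF n] by (intro Collect_cong conj_cong refl)
qed

theorem proposition27:
  fixes p m d :: nat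
  assumes "prime p" and "m \<ge> 1" and "d \<ge> 1"
  shows "real (card (carrier (polyfun_unit_group d (p ^ m)))) =
    ((real p - 1) / real p) ^ (p ^ d) * real (polyfun_count d (p ^ m))"
proof -
  let ?p = "int p" and ?n = "int p ^ m"
  let ?B = "residue_points ?p d"
  have p: "prime ?p" and p1: "p > 1"
    using assms(1) prime_gt_1_nat by auto
  have n: "?n > 1" using p1 assms(2) by (intro one_less_power) auto
  have pn: "?p dvd ?n" using assms(2) by (simp add: dvd_power)
  \<comment> \<open>the common size of the fibres, taken at the zero function\<close>
  define K where "K = card {f \<in> residue_polyfuns ?n d. reduce_polyfun ?p d f = (\<lambda>y\<in>?B. 0)}"
  have finB: "finite ?B"
    by (auto simp: residue_points_eq intro: finite_PiE)
  have "carrier (polyfun_unit_group d (p ^ m)) =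
      {f \<in> residue_polyfuns ?n d. reduce_polyfun ?p d f \<in> ?B \<rightarrow>\<^sub>E {1..<?p}}"
    using Units_residue_polyfuns_prime_power[OF p assms(2)]
    by (simp add: polyfun_unit_group_def units_of_def)
  also have "card \<dots> = card (?B \<rightarrow>\<^sub>E {1..<?p}) * K"
    unfolding K_def by (intro card_reduce_preimage[OF p n pn] PiE_mono) auto
  also have "card (?B \<rightarrow>\<^sub>E {1..<?p}) = (p - 1) ^ (p ^ d)"
    using finB by (simp add: card_PiE card_residue_points nat_diff_distrib')
  finally have U: "card (carrier (polyfun_unit_group d (p ^ m))) = (p - 1) ^ (p ^ d) * K" .
  have "residue_polyfuns ?n d =
      {f \<in> residue_polyfuns ?n d. reduce_polyfun ?p d f \<in> ?B \<rightarrow>\<^sub>E {0..<?p}}"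
    using p1 reduce_polyfun_in[of ?p d] by auto
  also have "card \<dots> = card (?B \<rightarrow>\<^sub>E {0..<?p}) * K"
    unfolding K_def by (intro card_reduce_preimage[OF p n pn]) auto
  also have "card (?B \<rightarrow>\<^sub>E {0..<?p}) = p ^ (p ^ d)"
    using finB by (simp add: card_PiE card_residue_points)
  finally have A: "polyfun_count d (p ^ m) = p ^ (p ^ d) * K"
    by (simp add: polyfun_count_def)
  show ?thesis
    using p1 by (simp add: U A power_divide of_nat_diff)
qed

end
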